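(* For each of the following eight parameter sets $(n,k,t,\lambda,\mu)$ there exists a directed strongly regular graph with parameters $(n,k,t,\lambda,\mu)$: $$(72,25,15,6,10),\ (96,11,4,3,1),\ (96,22,16,8,4),\ (96,26,11,7,7),$$ $$(96,29,23,10,8),\ (96,42,32,16,20),\ (96,45,35,22,20),\ (165,60,36,23,21).$$
   Context: A directed graph (digraph) is a pair $(\mathcal{V},\mathcal{A})$ with $\mathcal{V}$ a non-empty finite set and $\mathcal{A}$ a set of ordered pairs of distinct vertices (no loops); $x\to y$ means $(x,y)\in\mathcal{A}$. It is $k$-regular if every vertex has exactly $k$ in-neighbors and exactly $k$ out-neighbors. A directed strongly regular graph with parameters $(n,k,t,\lambda,\mu)$ is a $k$-regular digraph on $n$ vertices such that each vertex is incident with $t$ undirected edges (i.e. for each $x$ there are exactly $t$ vertices $y$ with $x\to y$ and $y\to x$), and for any two distinct vertices $x,y$ the number of paths $x\to z\to y$ of length 2 from $x$ to $y$ is $\lambda$ if $x\to y$ and $\mu$ otherwise. Equivalently, its adjacency matrix $A$ (a $\{0,1\}$-matrix with zero diagonal) satisfies $AJ=JA=kJ$ and $A^2=tI+\lambda A+\mu(J-I-A)$, where $I$ is the identity matrix and $J$ the all-one matrix of order $n$. *)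

theory Defs
  imports "Graph_Theory.Pair_Digraph"
begin

text \<open>
  Digraphs are the library's \<^locale>\<open>pair_digraph\<close>: a finite vertex set
  \<^term>\<open>pverts G\<close> and a set \<^term>\<open>parcs G\<close> of ordered pairs of distinct
  vertices. Since that locale admits the null graph, nonemptiness is required separately.
\<close>

definition regular_digraph :: "nat \<Rightarrow> 'a pair_pre_digraph \<Rightarrow> bool" where
  "regular_digraph k G \<longleftrightarrow> pair_digraph G \<and> pverts G \<noteq> {} \<and>
     (\<forall>x\<in>pverts G. in_degree (with_proj G) x = k \<and> out_degree (with_proj G) x = k)"

definition directed_srg ::
    "nat \<Rightarrow> nat \<Rightarrow> nat \<Rightarrow> nat \<Rightarrow> nat \<Rightarrow> 'a pair_pre_digraph \<Rightarrow> bool" where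
  "directed_srg n k t l \<mu> G \<longleftrightarrow>
     regular_digraph k G \<and>
     card (pverts G) = n \<and>
     (\<forall>x\<in>pverts G. card {y \<in> pverts G. (x, y) \<in> parcs G \<and> (y, x) \<in> parcs G} = t) \<and>
     (\<forall>x\<in>pverts G. \<forall>y\<in>pverts G. x \<noteq> y \<longrightarrow>
        card {z \<in> pverts G. (x, z) \<in> parcs G \<and> (z, y) \<in> parcs G} =
          (if (x, y) \<in> parcs G then l else \<mu>))"

end

theory Submission
  imports Defs "HOL-Library.Z2" "HOL-Algebra.Group"
begin

text \<open>
  A \<open>k\<close>-regular digraph with adjacency matrix \<open>A\<close> is directed strongly regular when \<open>A\<^sup>2\<close> is a
  combination of \<open>I\<close>, \<open>A\<close> and \<open>J\<close>. Such an equation can be shifted to \<open>(A + s I)\<^sup>2 = a (A + s I) + m J\<close>, and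
  for each of the eight parameter sets a structure is exhibited in which a shifted matrix of this
  kind arises.

  For 165 vertices, the vertices are the triples of points of a Steiner system S(4,5,11). Each
  triple \<open>X\<close> is tied to seven pairs of points, the three inside \<open>X\<close> and the four that complete \<open>X\<close> to
  a block, and an arc goes from \<open>X\<close> to each other triple that contains a pair tied to \<open>X\<close>. If \<open>M\<close> is the matrix
  of this relation and \<open>N\<close> the inclusion matrix of pairs in triples, then \<open>A + 3 I = M N\<close> and
  \<open>N M = 8 I + J\<close> (\<open>card_tied_within\<close>, \<open>card_tied_over\<close>), which gives
  \<open>(A + 3 I)\<^sup>2 = 8 (A + 3 I) + 21 J\<close> (\<open>factorization_directed_srg\<close>). The Steiner system is made of 66 explicit
  blocks; it is the system whose automorphism group is the Mathieu group of degree 11.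

  For 72 and 96 vertices, the graphs are Cayley digraphs of groups of pairs or triples of \<open>2 \<times> 2\<close>
  matrices over the field with two elements, namely \<open>A\<^sub>4 \<times> S\<^sub>3\<close> and two extensions of the elementary
  abelian group \<open>V\<close> of order 16 by groups of order six. By \<open>cayley_directed_srg\<close> it suffices to count
  the factorisations of each group element into two connection elements. For 96 vertices, the connection
  sets are assembled from cosets of subgroups of order four of \<open>V\<close> that pairwise meet trivially: two such
  cosets multiply either to four copies of a coset or to a coset of \<open>V\<close>, so that the square of the
  connection set is again made of few kinds of pieces; for 72 vertices, lines in a plane over the field
  with two elements do the same. The resulting counts are made by rewriting (\<open>directed_srg_of_table\<close>).
\<close>

section \<open>Digraphs given by a relation\<close>

definition rel_digraph :: "'a set \<Rightarrow> ('a \<Rightarrow> 'a \<Rightarrow> bool) \<Rightarrow> 'a pair_pre_digraph" where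
  "rel_digraph V R = \<lparr>pverts = V, parcs = {(x, y). x \<in> V \<and> y \<in> V \<and> R x y}\<rparr>"

lemma rel_digraph_simps [simp]:
  "pverts (rel_digraph V R) = V"
  "(x, y) \<in> parcs (rel_digraph V R) \<longleftrightarrow> x \<in> V \<and> y \<in> V \<and> R x y"
  by (simp_all add: rel_digraph_def)

lemma directed_srg_rel_digraphI:
  assumes fin: "finite V" and ne: "V \<noteq> {}" and irrefl: "\<And>x. x \<in> V \<Longrightarrow> \<not> R x x"
    and out: "\<And>x. x \<in> V \<Longrightarrow> card {y \<in> V. R x y} = k"
    and inn: "\<And>x. x \<in> V \<Longrightarrow> card {y \<in> V. R y x} = k"
    and mutual: "\<And>x. x \<in> V \<Longrightarrow> card {y \<in> V. R x y \<and> R y x} = t"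
    and paths: "\<And>x y. x \<in> V \<Longrightarrow> y \<in> V \<Longrightarrow> x \<noteq> y \<Longrightarrow>
      card {z \<in> V. R x z \<and> R z y} = (if R x y then l else m)"
  shows "directed_srg (card V) k t l m (rel_digraph V R)"
proof -
  let ?G = "rel_digraph V R"
  have dig: "pair_digraph ?G"
  proof
    have "parcs ?G \<subseteq> V \<times> V" by auto
    then show "finite (parcs ?G)" using fin by (meson finite_SigmaI finite_subset)
  qed (use fin irrefl in auto)
  have "in_degree (with_proj ?G) x = k \<and> out_degree (with_proj ?G) x = k" if x: "x \<in> V" for x
  proof
    have "in_arcs (with_proj ?G) x = (\<lambda>y. (y, x)) ` {y \<in> V. R y x}"
      using x by (auto simp: in_arcs_def)
    then show "in_degree (with_proj ?G) x = k"
      using inn[OF x] by (simp add: in_degree_def card_image inj_on_def)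
    have "out_arcs (with_proj ?G) x = (\<lambda>y. (x, y)) ` {y \<in> V. R x y}"
      using x by (auto simp: out_arcs_def)
    then show "out_degree (with_proj ?G) x = k"
      using out[OF x] by (simp add: out_degree_def card_image inj_on_def)
  qed
  moreover have "card {y \<in> V. (x, y) \<in> parcs ?G \<and> (y, x) \<in> parcs ?G} = t" if x: "x \<in> V" for x
  proof -
    have "{y \<in> V. (x, y) \<in> parcs ?G \<and> (y, x) \<in> parcs ?G} = {y \<in> V. R x y \<and> R y x}"
      using x by auto
    then show ?thesis using mutual[OF x] by simp
  qed
  moreover have "card {z \<in> V. (x, z) \<in> parcs ?G \<and> (z, y) \<in> parcs ?G} =
      (if (x, y) \<in> parcs ?G then l else m)" if xy: "x \<in> V" "y \<in> V" "x \<noteq> y" for x y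
  proof -
    have "{z \<in> V. (x, z) \<in> parcs ?G \<and> (z, y) \<in> parcs ?G} = {z \<in> V. R x z \<and> R z y}"
      using xy by auto
    then show ?thesis using paths[OF xy] xy by simp
  qed
  ultimately show ?thesis
    using dig ne by (simp add: directed_srg_def regular_digraph_def del: rel_digraph_simps(2))
qed

text \<open>
  Only the relation between vertices matters, so a graph may be built on whatever vertices suit
  its construction and then relabelled by natural numbers.
\<close>

lemma directed_srg_on_nat:
  fixes V :: "'a set"
  assumes G: "directed_srg n k t l m (rel_digraph V R)"
  shows "\<exists>H :: nat pair_pre_digraph. directed_srg n k t l m H"
proof -
  let ?G = "rel_digraph V R"
  have dig: "pair_digraph ?G"
    using G by (simp add: directed_srg_def regular_digraph_def)
  then have fin: "finite V"
    using pair_fin_digraph.pair_finite_verts[of ?G] by (simp add: pair_digraph_def)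
  then obtain f :: "'a \<Rightarrow> nat" where f: "inj_on f V"
    using finite_imp_inj_to_nat_seg by metis
  let ?g = "the_inv_into V f"
  define R' where "R' = (\<lambda>x y. R (?g x) (?g y))"
  have R': "R' (f x) (f y) = R x y" if "x \<in> V" "y \<in> V" for x y
    using that f by (simp add: R'_def the_inv_into_f_f)
  have count: "card {z \<in> f ` V. P z} = card {z \<in> V. P (f z)}" for P
  proof -
    have "{z \<in> f ` V. P z} = f ` {z \<in> V. P (f z)}" by auto
    then show ?thesis using f by (simp add: card_image inj_on_subset)
  qed
  have count': "card {z \<in> f ` V. P z} = card {z \<in> V. Q z}"
    if "\<And>z. z \<in> V \<Longrightarrow> P (f z) = Q z" for P Q
    unfolding count by (rule arg_cong[where f = card]) (use that in auto)
  have irrefl: "\<not> R x x" if "x \<in> V" for x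
    using pair_loopfree_digraph.pair_no_loops[of ?G "(x, x)"] dig that by (auto simp: pair_digraph_def)
  have "card {y \<in> V. R x y} = k \<and> card {y \<in> V. R y x} = k" if x: "x \<in> V" for x
  proof -
    have "in_arcs (with_proj ?G) x = (\<lambda>y. (y, x)) ` {y \<in> V. R y x}"
      using x by (auto simp: in_arcs_def)
    moreover have "out_arcs (with_proj ?G) x = (\<lambda>y. (x, y)) ` {y \<in> V. R x y}"
      using x by (auto simp: out_arcs_def)
    ultimately show ?thesis
      using G x by (auto simp: directed_srg_def regular_digraph_def in_degree_def out_degree_def
          card_image inj_on_def)
  qed
  note degrees = this
  have mutual: "card {y \<in> V. R x y \<and> R y x} = t" if x: "x \<in> V" for x
  proof -
    have eq: "{y \<in> V. (x, y) \<in> parcs ?G \<and> (y, x) \<in> parcs ?G} = {y \<in> V. R x y \<and> R y x}"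
      using x by auto
    have "\<forall>x\<in>V. card {y \<in> V. (x, y) \<in> parcs ?G \<and> (y, x) \<in> parcs ?G} = t"
      using G[unfolded directed_srg_def rel_digraph_simps(1)] by (elim conjE)
    from bspec[OF this x] show ?thesis unfolding eq .
  qed
  have paths: "card {z \<in> V. R x z \<and> R z y} = (if R x y then l else m)"
    if xy: "x \<in> V" "y \<in> V" "x \<noteq> y" for x y
  proof -
    have eq: "{z \<in> V. (x, z) \<in> parcs ?G \<and> (z, y) \<in> parcs ?G} = {z \<in> V. R x z \<and> R z y}"
      "(x, y) \<in> parcs ?G \<longleftrightarrow> R x y"
      using xy by auto
    have "\<forall>x\<in>V. \<forall>y\<in>V. x \<noteq> y \<longrightarrow>
        card {z \<in> V. (x, z) \<in> parcs ?G \<and> (z, y) \<in> parcs ?G} =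
          (if (x, y) \<in> parcs ?G then l else m)"
      using G[unfolded directed_srg_def rel_digraph_simps(1)] by (elim conjE)
    from bspec[OF bspec[OF this xy(1)] xy(2)] xy(3) show ?thesis unfolding eq by (rule mp)
  qed
  have "directed_srg (card (f ` V)) k t l m (rel_digraph (f ` V) R')"
  proof (rule directed_srg_rel_digraphI)
    show "finite (f ` V)" using fin by simp
    show "f ` V \<noteq> {}" using G by (simp add: directed_srg_def regular_digraph_def)
  next
    fix x assume "x \<in> f ` V"
    then obtain u where u: "u \<in> V" "x = f u" by auto
    show "\<not> R' x x" using u irrefl by (simp add: R')
    show "card {y \<in> f ` V. R' x y} = k"
      using degrees[OF u(1)] count'[of "\<lambda>y. R' x y" "R u"] u by (simp add: R')
    show "card {y \<in> f ` V. R' y x} = k"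
      using degrees[OF u(1)] count'[of "\<lambda>y. R' y x" "\<lambda>y. R y u"] u by (simp add: R')
    show "card {y \<in> f ` V. R' x y \<and> R' y x} = t"
      using mutual[OF u(1)] count'[of "\<lambda>y. R' x y \<and> R' y x" "\<lambda>y. R u y \<and> R y u"] u
      by (simp add: R')
    fix y assume "y \<in> f ` V" and ne: "x \<noteq> y"
    then obtain v where v: "v \<in> V" "y = f v" by auto
    have "u \<noteq> v" using ne u v by auto
    then show "card {z \<in> f ` V. R' x z \<and> R' z y} = (if R' x y then l else m)"
      using paths[OF u(1) v(1)] count'[of "\<lambda>z. R' x z \<and> R' z y" "\<lambda>z. R u z \<and> R z v"] u v
      by (simp add: R')
  qed
  moreover have "card (f ` V) = n"
    using G f by (simp add: directed_srg_def card_image)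
  ultimately show ?thesis by blast
qed

section \<open>Cayley digraphs\<close>

text \<open>
  Left translations are automorphisms acting transitively, so the counts need to be made at the
  identity only. A walk of length two from the identity to \<open>g\<close> is a factorisation \<open>g = s \<otimes> s'\<close> with
  \<open>s\<close> and \<open>s'\<close> in \<open>S\<close>, and for \<open>g = \<one>\<close> these walks are the undirected edges at the identity. Hence a
  single count of factorisations carries the three parameters \<open>t\<close>, \<open>l\<close> and \<open>m\<close>; in the group ring it
  is the equation \<open>S\<^sup>2 = t \<one> + l S + m (G - \<one> - S)\<close>.
\<close>

lemma (in group) cayley_directed_srg:
  assumes fin: "finite (carrier G)" and S: "S \<subseteq> carrier G" "\<one> \<notin> S" and k: "card S = k"
    and count: "\<And>g. g \<in> carrier G \<Longrightarrow>
      card {s \<in> S. inv s \<otimes> g \<in> S} = (if g = \<one> then t else if g \<in> S then l else m)"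
  shows "directed_srg (card (carrier G)) k t l m (rel_digraph (carrier G) (\<lambda>x y. inv x \<otimes> y \<in> S))"
proof (rule directed_srg_rel_digraphI)
  show "finite (carrier G)" by fact
  show "carrier G \<noteq> {}" by auto
next
  fix x assume x: "x \<in> carrier G"
  show "inv x \<otimes> x \<notin> S" using x S by simp
  have "bij_betw (\<lambda>s. x \<otimes> s) S {y \<in> carrier G. inv x \<otimes> y \<in> S}"
    by (rule bij_betw_byWitness[where f' = "\<lambda>y. inv x \<otimes> y"])
      (use x S in \<open>auto simp: subset_iff m_assoc[symmetric]\<close>)
  then show "card {y \<in> carrier G. inv x \<otimes> y \<in> S} = k"
    using k bij_betw_same_card by fastforce
  have "bij_betw (\<lambda>s. x \<otimes> inv s) S {y \<in> carrier G. inv y \<otimes> x \<in> S}"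
  proof (rule bij_betw_byWitness[where f' = "\<lambda>y. inv y \<otimes> x"])
    show inv_shift: "\<forall>s\<in>S. inv (x \<otimes> inv s) \<otimes> x = s"
      using x S by (auto simp: subset_iff inv_mult_group m_assoc)
    show "\<forall>y\<in>{y \<in> carrier G. inv y \<otimes> x \<in> S}. x \<otimes> inv (inv y \<otimes> x) = y"
      using x by (auto simp: inv_mult_group m_assoc[symmetric])
    show "(\<lambda>s. x \<otimes> inv s) ` S \<subseteq> {y \<in> carrier G. inv y \<otimes> x \<in> S}"
      using x S inv_shift by auto
  qed auto
  then show "card {y \<in> carrier G. inv y \<otimes> x \<in> S} = k"
    using k bij_betw_same_card by fastforce
  have walks: "card {z \<in> carrier G. inv x \<otimes> z \<in> S \<and> inv z \<otimes> y \<in> S} =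
      card {s \<in> S. inv s \<otimes> (inv x \<otimes> y) \<in> S}" if y: "y \<in> carrier G" for y
  proof -
    have cancel: "inv (inv x \<otimes> z) \<otimes> (inv x \<otimes> y) = inv z \<otimes> y" if "z \<in> carrier G" for z
    proof -
      have "x \<otimes> (inv x \<otimes> y) = y" using x y by (simp add: m_assoc[symmetric])
      then show ?thesis using x y that by (simp add: inv_mult_group m_assoc)
    qed
    have unshift: "x \<otimes> (inv x \<otimes> z) = z" "inv x \<otimes> (x \<otimes> z) = z" if "z \<in> carrier G" for z
      using x that by (simp_all add: m_assoc[symmetric])
    have "bij_betw (\<lambda>s. x \<otimes> s) {s \<in> S. inv s \<otimes> (inv x \<otimes> y) \<in> S}
        {z \<in> carrier G. inv x \<otimes> z \<in> S \<and> inv z \<otimes> y \<in> S}"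
    proof (rule bij_betw_byWitness[where f' = "\<lambda>z. inv x \<otimes> z"])
      show "(\<lambda>s. x \<otimes> s) ` {s \<in> S. inv s \<otimes> (inv x \<otimes> y) \<in> S} \<subseteq>
          {z \<in> carrier G. inv x \<otimes> z \<in> S \<and> inv z \<otimes> y \<in> S}"
      proof clarify
        fix s assume s: "s \<in> S" "inv s \<otimes> (inv x \<otimes> y) \<in> S"
        then have "s \<in> carrier G" using S by auto
        then show "x \<otimes> s \<in> carrier G \<and> inv x \<otimes> (x \<otimes> s) \<in> S \<and> inv (x \<otimes> s) \<otimes> y \<in> S"
          using s x cancel[of "x \<otimes> s"] by (simp add: unshift)
      qed
      show "(\<lambda>z. inv x \<otimes> z) ` {z \<in> carrier G. inv x \<otimes> z \<in> S \<and> inv z \<otimes> y \<in> S} \<subseteq>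
          {s \<in> S. inv s \<otimes> (inv x \<otimes> y) \<in> S}"
        using cancel by auto
    qed (use S unshift in auto)
    then show ?thesis using bij_betw_same_card by fastforce
  qed
  show "card {y \<in> carrier G. inv x \<otimes> y \<in> S \<and> inv y \<otimes> x \<in> S} = t"
    using walks[OF x] count[of \<one>] x by simp
  fix y assume y: "y \<in> carrier G" and "x \<noteq> y"
  then have "inv x \<otimes> y \<noteq> \<one>" using x by (metis inv_equality inv_inv inv_closed)
  then show "card {z \<in> carrier G. inv x \<otimes> z \<in> S \<and> inv z \<otimes> y \<in> S} =
      (if inv x \<otimes> y \<in> S then l else m)"
    using walks[OF y] count[of "inv x \<otimes> y"] x y by simp
qed

section \<open>Factorisations of a shifted adjacency matrix\<close>

text \<open>
  Write \<open>A\<close> for the adjacency matrix and suppose that \<open>A + s I = M N\<close> with \<open>N M = a I + c J\<close>. Then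
  \<open>(A + s I)\<^sup>2 = M (N M) N = a (A + s I) + c (M J N)\<close>, and \<open>M J N\<close> is \<open>r r' J\<close> because \<open>M\<close> has constant
  row sum \<open>r\<close> and \<open>N\<close> has constant column sum \<open>r'\<close>; this is the quadratic equation of a directed
  strongly regular graph. Regularity comes for free: multiplying \<open>N M = a I + c J\<close> by the all-one
  vector on either side shows that the other line sums of \<open>M\<close> and \<open>N\<close> are constant too, hence so are
  the row and column sums of \<open>A\<close>.
\<close>

lemma factorization_directed_srg:
  fixes M :: "'a \<Rightarrow> 'b \<Rightarrow> int" and N :: "'b \<Rightarrow> 'a \<Rightarrow> int"
  assumes fin: "finite V" "finite Q" and ne: "V \<noteq> {}" and irrefl: "\<And>x. x \<in> V \<Longrightarrow> \<not> R x x"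
    and MN: "\<And>x y. x \<in> V \<Longrightarrow> y \<in> V \<Longrightarrow>
      (\<Sum>q\<in>Q. M x q * N q y) = of_bool (R x y) + s * of_bool (x = y)"
    and NM: "\<And>p q. p \<in> Q \<Longrightarrow> q \<in> Q \<Longrightarrow> (\<Sum>z\<in>V. N p z * M z q) = a * of_bool (p = q) + c"
    and M_row: "\<And>x. x \<in> V \<Longrightarrow> (\<Sum>q\<in>Q. M x q) = r" and "r \<noteq> 0"
    and N_col: "\<And>y. y \<in> V \<Longrightarrow> (\<Sum>q\<in>Q. N q y) = r'" and "r' \<noteq> 0"
    and k: "int k = a + c * int (card Q) - s"
    and t: "int t = a * s - s\<^sup>2 + c * r * r'"
    and l: "int l = a - 2 * s + c * r * r'"
    and m: "int m = c * r * r'"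
  shows "directed_srg (card V) k t l m (rel_digraph V R)"
proof (rule directed_srg_rel_digraphI)
  let ?B = "\<lambda>x y. \<Sum>q\<in>Q. M x q * N q y"
  have card_eq: "int (card {z \<in> V. P z}) = (\<Sum>z\<in>V. of_bool (P z))" for P
    using fin(1) by (simp add: sum.If_cases of_bool_def Int_def)
  have N_row: "r * (\<Sum>z\<in>V. N p z) = a + c * int (card Q)" if p: "p \<in> Q" for p
  proof -
    have "r * (\<Sum>z\<in>V. N p z) = (\<Sum>z\<in>V. N p z * (\<Sum>q\<in>Q. M z q))"
      by (simp add: sum_distrib_left M_row mult.commute)
    also have "\<dots> = (\<Sum>z\<in>V. \<Sum>q\<in>Q. N p z * M z q)"
      by (simp add: sum_distrib_left)
    also have "\<dots> = (\<Sum>q\<in>Q. a * of_bool (p = q) + c)"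
      by (subst sum.swap) (simp add: NM p)
    finally show ?thesis
      using fin p by (simp add: sum.distrib sum_distrib_left[symmetric] of_bool_def mult.commute)
  qed
  have M_col: "r' * (\<Sum>z\<in>V. M z q) = a + c * int (card Q)" if q: "q \<in> Q" for q
  proof -
    have "r' * (\<Sum>z\<in>V. M z q) = (\<Sum>z\<in>V. (\<Sum>p\<in>Q. N p z) * M z q)"
      by (simp add: sum_distrib_left N_col)
    also have "\<dots> = (\<Sum>z\<in>V. \<Sum>p\<in>Q. N p z * M z q)"
      by (simp add: sum_distrib_right)
    also have "\<dots> = (\<Sum>p\<in>Q. a * of_bool (p = q) + c)"
      by (subst sum.swap) (simp add: NM q)
    finally show ?thesis
      using fin q by (simp add: sum.distrib sum_distrib_left[symmetric] of_bool_def mult.commute)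
  qed
  fix x assume x: "x \<in> V"
  show "\<not> R x x" using irrefl x .
  have "r * (\<Sum>y\<in>V. ?B x y) = (\<Sum>q\<in>Q. M x q * (r * (\<Sum>y\<in>V. N q y)))"
    by (subst sum.swap) (simp add: sum_distrib_left algebra_simps)
  also have "\<dots> = r * (a + c * int (card Q))"
    by (simp add: N_row sum_distrib_right[symmetric] M_row x)
  finally have "(\<Sum>y\<in>V. ?B x y) = int k + s" using \<open>r \<noteq> 0\<close> k by simp
  moreover have "(\<Sum>y\<in>V. ?B x y) = (\<Sum>y\<in>V. of_bool (R x y)) + s"
    using x fin by (simp add: MN sum.distrib sum_distrib_left[symmetric] of_bool_def)
  ultimately show "card {y \<in> V. R x y} = k"
    using card_eq[of "R x"] by simp
  have "r' * (\<Sum>y\<in>V. ?B y x) = (\<Sum>q\<in>Q. (r' * (\<Sum>y\<in>V. M y q)) * N q x)"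
    by (subst sum.swap) (simp add: sum_distrib_left sum_distrib_right algebra_simps)
  also have "\<dots> = r' * (a + c * int (card Q))"
    by (simp add: M_col N_col x flip: sum_distrib_left)
  finally have "(\<Sum>y\<in>V. ?B y x) = int k + s" using \<open>r' \<noteq> 0\<close> k by simp
  moreover have "(\<Sum>y\<in>V. ?B y x) = (\<Sum>y\<in>V. of_bool (R y x)) + s"
    using x fin by (simp add: MN sum.distrib sum_distrib_left[symmetric] of_bool_def)
  ultimately show "card {y \<in> V. R y x} = k"
    using card_eq[of "\<lambda>y. R y x"] by simp
  have square: "(\<Sum>z\<in>V. ?B x z * ?B z y) = a * ?B x y + c * r * r'" if y: "y \<in> V" for y
  proof -
    have "(\<Sum>z\<in>V. ?B x z * ?B z y) =
        (\<Sum>z\<in>V. \<Sum>p\<in>Q. \<Sum>q\<in>Q. (M x p * N p z) * (M z q * N q y))"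
      by (simp add: sum_product)
    also have "\<dots> = (\<Sum>p\<in>Q. \<Sum>q\<in>Q. \<Sum>z\<in>V. (M x p * N p z) * (M z q * N q y))"
      by (subst sum.swap, rule sum.cong[OF refl], rule sum.swap)
    also have "\<dots> = (\<Sum>p\<in>Q. \<Sum>q\<in>Q. M x p * N q y * (\<Sum>z\<in>V. N p z * M z q))"
      by (simp add: sum_distrib_left algebra_simps)
    also have "\<dots> = (\<Sum>p\<in>Q. \<Sum>q\<in>Q. M x p * N q y * (a * of_bool (p = q) + c))"
      by (simp add: NM)
    also have "\<dots> = (\<Sum>p\<in>Q. \<Sum>q\<in>Q. (if p = q then a * (M x p * N p y) else 0)) +
        (\<Sum>p\<in>Q. \<Sum>q\<in>Q. c * (M x p * N q y))"
      unfolding sum.distrib[symmetric]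
      by (intro sum.cong refl) (simp add: algebra_simps)
    also have "\<dots> = a * ?B x y + c * (r * r')"
    proof -
      have "r * r' = (\<Sum>p\<in>Q. \<Sum>q\<in>Q. M x p * N q y)"
        unfolding M_row[OF x, symmetric] N_col[OF y, symmetric] by (rule sum_product)
      then show ?thesis using fin by (simp add: sum_distrib_left)
    qed
    finally show ?thesis by (simp add: mult.assoc)
  qed
  have walks: "int (card {z \<in> V. R x z \<and> R z y}) =
      a * (of_bool (R x y) + s * of_bool (x = y)) + c * r * r'
        - 2 * s * of_bool (R x y) - s\<^sup>2 * of_bool (x = y)" if y: "y \<in> V" for y
  proof -
    have "(\<Sum>z\<in>V. ?B x z * ?B z y) =
        (\<Sum>z\<in>V. (of_bool (R x z) + s * of_bool (x = z)) * (of_bool (R z y) + s * of_bool (z = y)))"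
      by (simp add: MN x y)
    also have "\<dots> = (\<Sum>z\<in>V. of_bool (R x z \<and> R z y)) +
        (\<Sum>z\<in>V. if z = y then s * of_bool (R x y) else 0) +
        (\<Sum>z\<in>V. if x = z then s * of_bool (R x y) + s\<^sup>2 * of_bool (x = y) else 0)"
      unfolding sum.distrib[symmetric]
      by (intro sum.cong refl) (auto simp: algebra_simps power2_eq_square)
    also have "\<dots> = int (card {z \<in> V. R x z \<and> R z y}) + 2 * s * of_bool (R x y)
        + s\<^sup>2 * of_bool (x = y)"
      using fin x y by (simp add: card_eq)
    finally show ?thesis using square[OF y] MN[OF x y] by simp
  qed
  show "card {y \<in> V. R x y \<and> R y x} = t"
    using walks[OF x] irrefl[OF x] t by simp
  fix y assume y: "y \<in> V" and "x \<noteq> y"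
  then show "card {z \<in> V. R x z \<and> R z y} = (if R x y then l else m)"
    using walks[OF y] l m by (cases "R x y") simp_all
qed (use fin ne in auto)

section \<open>Groups of matrices over the field with two elements\<close>

datatype mat2 = Mat bit bit bit bit

instantiation mat2 :: semiring_1
begin

definition zero_mat2 :: mat2 where "0 = Mat 0 0 0 0"

definition one_mat2 :: mat2 where "1 = Mat 1 0 0 1"

fun plus_mat2 :: "mat2 \<Rightarrow> mat2 \<Rightarrow> mat2" where
  "Mat a b c d + Mat a' b' c' d' = Mat (a + a') (b + b') (c + c') (d + d')"

fun times_mat2 :: "mat2 \<Rightarrow> mat2 \<Rightarrow> mat2" where
  "Mat a b c d * Mat a' b' c' d' = Mat (a*a' + b*c') (a*b' + b*d') (c*a' + d*c') (c*b' + d*d')"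

instance
proof
  fix A B C :: mat2
  show "A + B + C = A + (B + C)" "A + B = B + A" "A * B * C = A * (B * C)"
    "(A + B) * C = A * C + B * C" "A * (B + C) = A * B + A * C"
    by (cases A; cases B; cases C;
      simp only: plus_mat2.simps times_mat2.simps mat2.inject distrib_left distrib_right ac_simps)+
  show "0 + A = A" "0 * A = 0" "A * 0 = 0" "1 * A = A" "A * 1 = A"
    by (cases A; simp add: zero_mat2_def one_mat2_def)+
qed (simp add: zero_mat2_def one_mat2_def)

end

text \<open>
  The adjugate: in characteristic two its signs disappear, and on a matrix of determinant one it is
  the inverse.
\<close>

fun adj :: "mat2 \<Rightarrow> mat2" where
  "adj (Mat a b c d) = Mat d b c a"

text \<open>
  The four binary digits of a number below 16 are the entries of a matrix, row by row. For instance
  9 is the identity, 6 exchanges the coordinates, and 7 has order three.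
\<close>

definition mat_of :: "nat \<Rightarrow> mat2" where
  "mat_of n = Mat (of_bool (odd (n div 8))) (of_bool (odd (n div 4)))
     (of_bool (odd (n div 2))) (of_bool (odd n))"

lemma mat2_add_self [simp]: "X + X = (0 :: mat2)"
proof -
  have "x + x = 0" for x :: bit by (cases x) simp_all
  then show ?thesis by (cases X) (simp add: zero_mat2_def)
qed

text \<open>
  Subgroups of \<open>(F\<^sub>2\<^sup>2\<^sup>\<times>\<^sup>2 \<rtimes> GL(2,2)) \<times> GL(2,2)\<close>: the first two components multiply like the block
  matrices with rows \<open>(A, X)\<close> and \<open>(0, 1)\<close>, the third is an independent factor. A single family is
  enough for all seven Cayley digraphs below.
\<close>

definition mat_group ::
    "mat2 list \<Rightarrow> mat2 list \<Rightarrow> mat2 list \<Rightarrow> (mat2 \<times> mat2 \<times> mat2) monoid" where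
  "mat_group Xs As Bs =
     \<lparr>carrier = set Xs \<times> set As \<times> set Bs,
      mult = (\<lambda>(X, A, B) (Y, C, D). (X + A * Y, A * C, B * D)),
      one = (0, 1, 1)\<rparr>"

definition mat_subgroup :: "mat2 list \<Rightarrow> bool" where
  "mat_subgroup As \<longleftrightarrow> 1 \<in> set As \<and>
     (\<forall>A\<in>set As. adj A \<in> set As \<and> adj A * A = 1 \<and> (\<forall>C\<in>set As. A * C \<in> set As))"

definition invariant_under :: "mat2 list \<Rightarrow> mat2 list \<Rightarrow> bool" where
  "invariant_under As Xs \<longleftrightarrow> 0 \<in> set Xs \<and> (\<forall>X\<in>set Xs. \<forall>Y\<in>set Xs. X + Y \<in> set Xs) \<and>
     (\<forall>A\<in>set As. \<forall>X\<in>set Xs. A * X \<in> set Xs)"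

lemma mat_group_simps [simp]:
  "carrier (mat_group Xs As Bs) = set Xs \<times> set As \<times> set Bs"
  "(X, A, B) \<otimes>\<^bsub>mat_group Xs As Bs\<^esub> (Y, C, D) = (X + A * Y, A * C, B * D)"
  "\<one>\<^bsub>mat_group Xs As Bs\<^esub> = (0, 1, 1)"
  by (simp_all add: mat_group_def)

lemma group_mat_group:
  assumes As: "mat_subgroup As" and Bs: "mat_subgroup Bs" and Xs: "invariant_under As Xs"
  shows "group (mat_group Xs As Bs)"
proof (rule groupI)
  fix g assume g: "g \<in> carrier (mat_group Xs As Bs)"
  obtain X A B where g_eq: "g = (X, A, B)" by (cases g)
  let ?h = "(adj A * X, adj A, adj B)"
  have "?h \<in> carrier (mat_group Xs As Bs)"
    using g g_eq assms by (auto simp: mat_subgroup_def invariant_under_def)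
  moreover have "?h \<otimes>\<^bsub>mat_group Xs As Bs\<^esub> g = \<one>\<^bsub>mat_group Xs As Bs\<^esub>"
    using g g_eq As Bs by (auto simp: mat_subgroup_def distrib_left[symmetric])
  ultimately show "\<exists>h\<in>carrier (mat_group Xs As Bs).
      h \<otimes>\<^bsub>mat_group Xs As Bs\<^esub> g = \<one>\<^bsub>mat_group Xs As Bs\<^esub>" by blast
qed (use assms in \<open>auto simp: mat_subgroup_def invariant_under_def algebra_simps\<close>)

lemma mat_group_inv:
  assumes As: "mat_subgroup As" and Bs: "mat_subgroup Bs" and Xs: "invariant_under As Xs"
    and g: "(X, A, B) \<in> carrier (mat_group Xs As Bs)"
  shows "inv\<^bsub>mat_group Xs As Bs\<^esub> (X, A, B) = (adj A * X, adj A, adj B)"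
  by (rule group.inv_equality[OF group_mat_group[OF As Bs Xs]])
    (use assms in \<open>auto simp: mat_subgroup_def invariant_under_def distrib_left[symmetric]\<close>)

section \<open>Connection sets given by tables\<close>

text \<open>
  A connection set is listed fibre by fibre over its two invertible components: the entry at
  \<open>(A, B)\<close> consists of those \<open>X\<close> for which \<open>(X, A, B)\<close> is a connection element. A missing entry is
  empty.
\<close>

type_synonym table = "((mat2 \<times> mat2) \<times> mat2 list) list"

definition entry :: "table \<Rightarrow> mat2 \<Rightarrow> mat2 \<Rightarrow> mat2 list" where
  "entry d A B = (case map_of d (A, B) of None \<Rightarrow> [] | Some Xs \<Rightarrow> Xs)"

definition table_of :: "((nat \<times> nat) \<times> nat list) list \<Rightarrow> table" where
  "table_of = map (\<lambda>((a, b), xs). ((mat_of a, mat_of b), map mat_of xs))"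

text \<open>
  The number of elements \<open>s = (X, A, B)\<close> of the connection set for which \<open>s\<^sup>-\<^sup>1 (Y, E, F)\<close> lies in it
  as well. The argument of the adjugate is \<open>Y - X\<close>, written as a sum since the characteristic is two.
\<close>

definition representations :: "mat2 list \<Rightarrow> mat2 list \<Rightarrow> table \<Rightarrow> mat2 \<Rightarrow> mat2 \<Rightarrow> mat2 \<Rightarrow> nat" where
  "representations As Bs d Y E F = (\<Sum>A\<leftarrow>As. \<Sum>B\<leftarrow>Bs.
     length (filter (\<lambda>X. adj A * (X + Y) \<in> set (entry d (adj A * E) (adj B * F))) (entry d A B)))"

text \<open>
  The hypotheses of the criterion for Cayley digraphs in a form that can be decided by rewriting.
  Testing \<open>s\<^sup>-\<^sup>1 g\<close> for membership, rather than tabulating all products, keeps every list short; the cost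
  of rewriting grows quickly with the length of the lists.
\<close>

definition dsrg_table ::
    "mat2 list \<Rightarrow> mat2 list \<Rightarrow> mat2 list \<Rightarrow> table \<Rightarrow> nat \<Rightarrow> nat \<Rightarrow> nat \<Rightarrow> nat \<Rightarrow> nat \<Rightarrow> bool" where
  "dsrg_table Xs As Bs d n k t l m \<longleftrightarrow>
     mat_subgroup As \<and> mat_subgroup Bs \<and> invariant_under As Xs \<and>
     distinct Xs \<and> distinct As \<and> distinct Bs \<and> n = length Xs * length As * length Bs \<and>
     (\<forall>A\<in>set As. \<forall>B\<in>set Bs. distinct (entry d A B) \<and> set (entry d A B) \<subseteq> set Xs) \<and>
     0 \<notin> set (entry d 1 1) \<and>
     (\<Sum>A\<leftarrow>As. \<Sum>B\<leftarrow>Bs. length (entry d A B)) = k \<and>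
     (\<forall>E\<in>set As. \<forall>F\<in>set Bs. \<forall>Y\<in>set Xs. representations As Bs d Y E F =
        (if (Y, E, F) = (0, 1, 1) then t
         else if Y \<in> set (entry d E F) then l else m))"

lemma card_table:
  assumes As: "distinct As" and Bs: "distinct Bs"
    and Xs: "\<And>A B. A \<in> set As \<Longrightarrow> B \<in> set Bs \<Longrightarrow> distinct (T A B)"
  shows "card {(X, A, B). A \<in> set As \<and> B \<in> set Bs \<and> X \<in> set (T A B) \<and> P X A B} =
    (\<Sum>A\<leftarrow>As. \<Sum>B\<leftarrow>Bs. length (filter (\<lambda>X. P X A B) (T A B)))"
proof -
  let ?S = "{(X, A, B). A \<in> set As \<and> B \<in> set Bs \<and> X \<in> set (T A B) \<and> P X A B}"
  let ?I = "SIGMA A:set As. SIGMA B:set Bs. set (filter (\<lambda>X. P X A B) (T A B))"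
  have "bij_betw (\<lambda>(A, B, X). (X, A, B)) ?I ?S"
    by (rule bij_betw_byWitness[where f' = "\<lambda>(X, A, B). (A, B, X)"]) auto
  then have "card ?S = card ?I" using bij_betw_same_card by fastforce
  also have "\<dots> = (\<Sum>A\<in>set As. \<Sum>B\<in>set Bs. length (filter (\<lambda>X. P X A B) (T A B)))"
    by (simp add: Xs distinct_card del: set_filter)
  finally show ?thesis
    using As Bs by (simp add: sum_list_distinct_conv_sum_set)
qed

lemma directed_srg_of_table:
  assumes "dsrg_table Xs As Bs d n k t l m"
  shows "\<exists>H :: nat pair_pre_digraph. directed_srg n k t l m H"
proof -
  let ?G = "mat_group Xs As Bs"
  have As: "mat_subgroup As" and Bs: "mat_subgroup Bs" and Xs: "invariant_under As Xs"
    and dist: "distinct Xs" "distinct As" "distinct Bs"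
    and n: "n = length Xs * length As * length Bs"
    and entries: "\<And>A B. A \<in> set As \<Longrightarrow> B \<in> set Bs \<Longrightarrow> distinct (entry d A B)"
      "\<And>A B. A \<in> set As \<Longrightarrow> B \<in> set Bs \<Longrightarrow> set (entry d A B) \<subseteq> set Xs"
    and loopless: "0 \<notin> set (entry d 1 1)"
    and k: "(\<Sum>A\<leftarrow>As. \<Sum>B\<leftarrow>Bs. length (entry d A B)) = k"
    and reps: "\<And>Y E F. E \<in> set As \<Longrightarrow> F \<in> set Bs \<Longrightarrow> Y \<in> set Xs \<Longrightarrow>
      representations As Bs d Y E F =
        (if (Y, E, F) = (0, 1, 1) then t
         else if Y \<in> set (entry d E F) then l else m)"
    using assms unfolding dsrg_table_def by blast+
  interpret group ?G by (rule group_mat_group[OF As Bs Xs])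
  define S where "S = {(X, A, B). A \<in> set As \<and> B \<in> set Bs \<and> X \<in> set (entry d A B)}"
  have S_sub: "S \<subseteq> carrier ?G" using entries(2) by (fastforce simp: S_def)
  have "directed_srg (card (carrier ?G)) k t l m
      (rel_digraph (carrier ?G) (\<lambda>x y. inv\<^bsub>?G\<^esub> x \<otimes>\<^bsub>?G\<^esub> y \<in> S))"
  proof (rule cayley_directed_srg)
    show "finite (carrier ?G)" by simp
    show "S \<subseteq> carrier ?G" by fact
    show "\<one>\<^bsub>?G\<^esub> \<notin> S" using loopless by (simp add: S_def)
    show "card S = k"
      using card_table[OF dist(2,3) entries(1), where P = "\<lambda>_ _ _. True"] k by (simp add: S_def)
    fix g assume g: "g \<in> carrier ?G"
    obtain Y E F where g_eq: "g = (Y, E, F)" by (cases g)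
    have "inv\<^bsub>?G\<^esub> (X, A, B) \<otimes>\<^bsub>?G\<^esub> g = (adj A * (X + Y), adj A * E, adj B * F)"
      if "(X, A, B) \<in> S" for X A B
      using that S_sub by (subst mat_group_inv[OF As Bs Xs]) (auto simp: g_eq distrib_left)
    moreover have "(X, A, B) \<in> S \<Longrightarrow> adj A * E \<in> set As \<and> adj B * F \<in> set Bs" for X A B
      using As Bs g g_eq by (auto simp: mat_subgroup_def S_def)
    ultimately have "{s \<in> S. inv\<^bsub>?G\<^esub> s \<otimes>\<^bsub>?G\<^esub> g \<in> S} =
        {(X, A, B). A \<in> set As \<and> B \<in> set Bs \<and> X \<in> set (entry d A B) \<and>
          adj A * (X + Y) \<in> set (entry d (adj A * E) (adj B * F))}"
      by (auto simp: S_def)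
    also have "card \<dots> = representations As Bs d Y E F"
      unfolding representations_def by (rule card_table[OF dist(2,3) entries(1)])
    finally show "card {s \<in> S. inv\<^bsub>?G\<^esub> s \<otimes>\<^bsub>?G\<^esub> g \<in> S} =
        (if g = \<one>\<^bsub>?G\<^esub> then t else if g \<in> S then l else m)"
      using reps[of E F Y] g g_eq by (simp add: S_def)
  qed
  moreover have "card (carrier ?G) = n"
    using dist n by (simp add: card_cartesian_product distinct_card)
  ultimately show ?thesis using directed_srg_on_nat by blast
qed

section \<open>Seven Cayley digraphs\<close>

text \<open>
  The six tables for 96 vertices are made from planes, that is, from additive subgroups of order
  four in the group \<open>V\<close> of all 16 matrices. Away from the identity of the invertible components,
  each entry is a coset of a plane or the complement of one. At the identity the entry is a union of
  planes without zero or, for degree 42, the complement of a union of planes. In each table, any two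
  different ones among the planes involved and their images under the matrices \<open>A\<close> meet in zero only.

  This is what makes the square of the connection set computable. The product of
  \<open>(X + P, A, B)\<close> and \<open>(Y + Q, C, D)\<close> lies over \<open>(A C, B D)\<close>; it covers \<open>V\<close> once if \<open>P \<noteq> A Q\<close>, and it
  covers the coset \<open>X + A Y + P\<close> four times if \<open>P = A Q\<close>. So the products contribute multiples of
  full fibres and multiples of cosets of planes, and the table is arranged so that all of them add up
  to a combination of the identity, the connection set and the whole group. For 72 vertices the same
  happens in the plane of matrices with vanishing second column: its three lines take the role of
  the planes, products of cosets cover a coset twice or the plane once, and some entries are full.
\<close>

definition "all_mats = map mat_of [0..<16]"
definition "first_column = map mat_of [0, 2, 8, 10]"
definition "GL2 = map mat_of [6, 7, 9, 11, 13, 14]"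
definition "C3 = map mat_of [9, 7, 14]"
definition "C2 = map mat_of [9, 6]"

text \<open>
  The group is \<open>A\<^sub>4 \<times> S\<^sub>3\<close>: the powers of an element of order three act on the four first columns,
  and the independent factor is \<open>GL(2,2)\<close>.
\<close>

lemma ex_dsrg_72_25: "\<exists>H :: nat pair_pre_digraph. directed_srg 72 25 15 6 10 H"
  by (rule directed_srg_of_table[where Xs = "first_column" and As = "C3" and Bs = "GL2" and
      d = "table_of
       [((7, 7), [2, 10]), ((7, 9), [0, 8]), ((7, 11), [0, 2, 8, 10]),
        ((9, 6), [0, 2, 8, 10]), ((9, 7), [0, 8]), ((9, 9), [2]), ((9, 14), [0, 10]),
        ((14, 9), [0, 10]), ((14, 13), [0, 2, 8, 10]), ((14, 14), [2, 8])]"])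
    code_simp

text \<open>
  Let \<open>P\<close> be the plane of matrices with vanishing first row. Together with the identity, the
  connection set \<open>S\<close> consists of one copy of \<open>P\<close> over each of the matrices 9, 6 and 7. Of these
  only 9, the identity matrix, maps \<open>P\<close> to itself. Hence in \<open>(S + 1)\<^sup>2\<close> the three products with left factor over
  9 yield \<open>4 (S + 1)\<close>, while the six others cover one full fibre each, and these are the six different
  ones because \<open>{6, 7}\<close> times \<open>{9, 6, 7}\<close> is all of \<open>GL(2,2)\<close>. So \<open>(S + 1)\<^sup>2 = 4 (S + 1) + G\<close>.
\<close>

lemma ex_dsrg_96_11: "\<exists>H :: nat pair_pre_digraph. directed_srg 96 11 4 3 1 H"
  by (rule directed_srg_of_table[where Xs = "all_mats" and As = "GL2" and Bs = "[1]" and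
      d = "table_of
       [((6, 9), [0, 1, 2, 3]), ((7, 9), [0, 1, 2, 3]), ((9, 9), [1, 2, 3])]"])
    code_simp

lemma ex_dsrg_96_22: "\<exists>H :: nat pair_pre_digraph. directed_srg 96 22 16 8 4 H"
  by (rule directed_srg_of_table[where Xs = "all_mats" and As = "GL2" and Bs = "[1]" and
      d = "table_of
       [((6, 9), [0, 4, 8, 12]), ((7, 9), [1, 5, 9, 13]), ((9, 9), [4, 5, 8, 10, 12, 15]),
        ((13, 9), [1, 4, 11, 14]), ((14, 9), [1, 4, 11, 14])]"])
    code_simp

lemma ex_dsrg_96_26: "\<exists>H :: nat pair_pre_digraph. directed_srg 96 26 11 7 7 H"
  by (rule directed_srg_of_table[where Xs = "all_mats" and As = "GL2" and Bs = "[1]" and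
      d = "table_of
       [((6, 9), [1, 6, 8, 15]), ((7, 9), [0, 5, 10, 15]), ((9, 9), [1, 2, 3, 6, 11, 13]),
        ((11, 9), [3, 4, 10, 13]), ((13, 9), [0, 7, 9, 14]), ((14, 9), [3, 7, 11, 15])]"])
    code_simp

text \<open>
  The only table over 96 vertices whose group is not \<open>V \<rtimes> GL(2,2)\<close>: it is the product of a group of
  order two and \<open>V\<close> extended by an element of order three.
\<close>

lemma ex_dsrg_96_29: "\<exists>H :: nat pair_pre_digraph. directed_srg 96 29 23 10 8 H"
  by (rule directed_srg_of_table[where Xs = "all_mats" and As = "C3" and Bs = "C2" and
      d = "table_of
       [((7, 6), [0, 1, 14, 15]), ((7, 9), [0, 5, 9, 12]), ((9, 6), [0, 2, 8, 10]),
        ((9, 9), [1, 2, 5, 8, 9, 10, 12, 14, 15]), ((14, 6), [0, 5, 9, 12]),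
        ((14, 9), [0, 1, 14, 15])]"])
    code_simp

text \<open>
  Here and for degree 45 the three planes are the sets of matrices annihilated on the left by one of
  the three nonzero row vectors; their union is the set of singular matrices. The two tables agree
  except at the identity, where the first has the invertible and the second has the nonzero singular
  matrices.
\<close>

lemma ex_dsrg_96_42: "\<exists>H :: nat pair_pre_digraph. directed_srg 96 42 32 16 20 H"
  by (rule directed_srg_of_table[where Xs = "all_mats" and As = "GL2" and Bs = "[1]" and
      d = "table_of
       [((6, 9), [0, 5, 10, 15]), ((7, 9), [0, 1, 2, 3, 8, 9, 10, 11, 12, 13, 14, 15]),
        ((9, 9), [6, 7, 9, 11, 13, 14]), ((11, 9), [0, 1, 2, 3]),
        ((13, 9), [1, 2, 3, 5, 6, 7, 9, 10, 11, 13, 14, 15]), ((14, 9), [2, 7, 8, 13])]"])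
    code_simp

lemma ex_dsrg_96_45: "\<exists>H :: nat pair_pre_digraph. directed_srg 96 45 35 22 20 H"
  by (rule directed_srg_of_table[where Xs = "all_mats" and As = "GL2" and Bs = "[1]" and
      d = "table_of
       [((6, 9), [0, 5, 10, 15]), ((7, 9), [0, 1, 2, 3, 8, 9, 10, 11, 12, 13, 14, 15]),
        ((9, 9), [1, 2, 3, 4, 5, 8, 10, 12, 15]), ((11, 9), [0, 1, 2, 3]),
        ((13, 9), [1, 2, 3, 5, 6, 7, 9, 10, 11, 13, 14, 15]), ((14, 9), [2, 7, 8, 13])]"])
    code_simp

section \<open>Triples of points in a Steiner system S(4,5,11)\<close>

locale steiner_4_5_11 =
  fixes P :: "'a set" and blocks :: "'a set set"
  assumes card_P: "card P = 11"
    and block_sub: "B \<in> blocks \<Longrightarrow> B \<subseteq> P"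
    and card_block: "B \<in> blocks \<Longrightarrow> card B = 5"
    and steiner: "F \<subseteq> P \<Longrightarrow> card F = 4 \<Longrightarrow> \<exists>!B. B \<in> blocks \<and> F \<subseteq> B"
begin

definition triples :: "'a set set" where
  "triples = {X. X \<subseteq> P \<and> card X = 3}"

definition pairs :: "'a set set" where
  "pairs = {q. q \<subseteq> P \<and> card q = 2}"

text \<open>
  The four blocks through a triple \<open>X\<close> cut the remaining eight points into four pairs. These four
  pairs and the three pairs inside \<open>X\<close> are the pairs tied to \<open>X\<close>; there is an arc from \<open>X\<close> to every
  other triple that contains one of them.
\<close>

definition tied :: "'a set \<Rightarrow> 'a set \<Rightarrow> bool" where
  "tied X q \<longleftrightarrow> q \<subseteq> X \<or> X \<inter> q = {} \<and> X \<union> q \<in> blocks"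

definition adjacent :: "'a set \<Rightarrow> 'a set \<Rightarrow> bool" where
  "adjacent X Y \<longleftrightarrow> X \<noteq> Y \<and> (\<exists>q\<in>pairs. tied X q \<and> q \<subseteq> Y)"

lemma finite_P: "finite P"
  using card_P card.infinite by fastforce

lemma finite_sub: "X \<subseteq> P \<Longrightarrow> finite X"
  using finite_P finite_subset by blast

lemma finite_triples: "finite triples" and card_triples: "card triples = 165"
  using finite_P n_subsets[OF finite_P, of 3]
  by (simp_all add: triples_def card_P eval_nat_numeral)

lemma finite_pairs: "finite pairs" and card_pairs: "card pairs = 55"
  using finite_P n_subsets[OF finite_P, of 2]
  by (simp_all add: pairs_def card_P eval_nat_numeral)

text \<open>
  Two blocks through \<open>X\<close> that share a further point share four points, so they coincide.
\<close>

lemma completions_disjoint: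
  assumes "X \<in> triples" "X \<union> q \<in> blocks" "X \<union> q' \<in> blocks" "X \<inter> q = {}" "X \<inter> q' = {}"
    and y: "y \<in> q" "y \<in> q'"
  shows "q = q'"
proof -
  have X: "X \<subseteq> P" "card X = 3" using assms by (auto simp: triples_def)
  have "insert y X \<subseteq> P" using block_sub assms(2) y by blast
  moreover have "card (insert y X) = 4"
    using X finite_sub assms(4) y by (subst card_insert_disjoint) auto
  ultimately have "X \<union> q = X \<union> q'"
    using steiner[of "insert y X"] assms by blast
  then show ?thesis using assms by blast
qed

lemma card_pairs_within:
  assumes "X \<in> triples"
  shows "card {q \<in> pairs. q \<subseteq> X} = 3"
proof -
  have X: "X \<subseteq> P" "card X = 3" "finite X"
    using assms finite_sub by (auto simp: triples_def)
  then have "{q \<in> pairs. q \<subseteq> X} = {q. q \<subseteq> X \<and> card q = 2}" by (auto simp: pairs_def)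
  then show ?thesis using n_subsets[OF X(3), of 2] X by (simp add: eval_nat_numeral)
qed

lemma card_completions:
  assumes "X \<in> triples"
  shows "card {q \<in> pairs. X \<inter> q = {} \<and> X \<union> q \<in> blocks} = 4"
proof -
  let ?D = "{q \<in> pairs. X \<inter> q = {} \<and> X \<union> q \<in> blocks}"
  have X: "X \<subseteq> P" "card X = 3" "finite X"
    using assms finite_sub by (auto simp: triples_def)
  have "x \<in> \<Union>?D" if x: "x \<in> P - X" for x
  proof -
    have "card (insert x X) = 4" using X x by simp
    then obtain B where B: "B \<in> blocks" "insert x X \<subseteq> B"
      using steiner[of "insert x X"] X x by blast
    have "card (B - X) = 2"
      using B X card_block by (simp add: card_Diff_subset)
    then have "B - X \<in> ?D"
      using B block_sub by (auto simp: pairs_def Un_absorb1)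
    then show ?thesis using B x by blast
  qed
  moreover have "\<Union>?D \<subseteq> P - X" by (auto simp: pairs_def)
  ultimately have "\<Union>?D = P - X" by blast
  moreover have "card (P - X) = 8"
    using X card_P by (simp add: card_Diff_subset)
  moreover have "card (\<Union>?D) = sum card ?D"
  proof (rule card_Union_disjoint)
    show "pairwise disjnt ?D"
    proof (rule pairwiseI)
      fix q q' assume D: "q \<in> ?D" "q' \<in> ?D" "q \<noteq> q'"
      have "y \<notin> q'" if "y \<in> q" for y
        using completions_disjoint[OF assms, of q q' y] D that by auto
      then show "disjnt q q'" by (auto simp: disjnt_def)
    qed
  qed (use finite_sub in \<open>auto simp: pairs_def\<close>)
  moreover have "sum card ?D = 2 * card ?D" by (simp add: pairs_def)
  ultimately show ?thesis by simp
qed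

lemma card_tied:
  assumes "X \<in> triples"
  shows "card {q \<in> pairs. tied X q} = 7"
proof -
  let ?D = "{q \<in> pairs. X \<inter> q = {} \<and> X \<union> q \<in> blocks}"
  have "{q \<in> pairs. tied X q} = {q \<in> pairs. q \<subseteq> X} \<union> ?D"
    by (auto simp: tied_def)
  moreover have "{q \<in> pairs. q \<subseteq> X} \<inter> ?D = {}"
  proof (rule equals0I)
    fix q assume "q \<in> {q \<in> pairs. q \<subseteq> X} \<inter> ?D"
    then have "q = {}" "card q = 2" by (auto simp: pairs_def)
    then show False by simp
  qed
  ultimately show ?thesis
    using finite_pairs card_pairs_within[OF assms] card_completions[OF assms]
    by (simp add: card_Un_disjoint)
qed

text \<open>
  Two different pairs inside a triple share a point \<open>y\<close> and cover the triple. If \<open>y\<close> is in \<open>X\<close>, both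
  tied pairs are inside \<open>X\<close>, and \<open>Y = X\<close>; otherwise both complete \<open>X\<close> to a block containing \<open>y\<close>.
  Therefore the product of the matrices of \<open>tied\<close> and of inclusion counts nothing twice off the
  diagonal and equals \<open>A + 3 I\<close>, the diagonal coming from the three pairs inside a triple.
\<close>

lemma tied_unique:
  assumes X: "X \<in> triples" and Y: "Y \<in> triples" and "X \<noteq> Y"
    and q: "q \<in> pairs" "tied X q" "q \<subseteq> Y" and q': "q' \<in> pairs" "tied X q'" "q' \<subseteq> Y"
  shows "q = q'"
proof (rule ccontr)
  assume "q \<noteq> q'"
  have fin: "finite q" "finite q'" "finite X" "finite Y" and card: "card q = 2" "card q' = 2"
    and cardXY: "card X = 3" "card Y = 3"
    using X Y q(1) q'(1) finite_sub by (auto simp: triples_def pairs_def)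
  have "q \<noteq> q \<union> q'" using \<open>q \<noteq> q'\<close> card fin by (metis Un_upper2 card_subset_eq)
  then have "2 < card (q \<union> q')"
    using fin card psubset_card_mono[of "q \<union> q'" q] by auto
  moreover have "card (q \<union> q') \<le> card Y"
    using q(3) q'(3) fin by (simp add: card_mono)
  ultimately have union: "card (q \<union> q') = 3" using cardXY by simp
  then have Y_eq: "q \<union> q' = Y"
    using q(3) q'(3) fin cardXY by (simp add: card_subset_eq)
  have "card (q \<inter> q') = 1"
    using card_Un_Int[OF fin(1,2)] card union by simp
  then obtain y where y: "y \<in> q" "y \<in> q'" by (metis IntE One_nat_def card_1_singletonE insertI1)
  show False
  proof (cases "y \<in> X")
    case True
    then have "Y \<subseteq> X" using q(2) q'(2) y Y_eq by (auto simp: tied_def)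
    then show False using fin cardXY \<open>X \<noteq> Y\<close> card_subset_eq by metis
  next
    case False
    then show False
      using completions_disjoint[OF X, of q q' y] q(2) q'(2) y \<open>q \<noteq> q'\<close> by (auto simp: tied_def)
  qed
qed

lemma card_tied_within:
  assumes X: "X \<in> triples" and Y: "Y \<in> triples"
  shows "card {q \<in> pairs. tied X q \<and> q \<subseteq> Y} = of_bool (adjacent X Y) + 3 * of_bool (X = Y)"
proof (cases "X = Y")
  case True
  have "{q \<in> pairs. tied X q \<and> q \<subseteq> X} = {q \<in> pairs. q \<subseteq> X}"
    by (auto simp: tied_def)
  then show ?thesis using True card_pairs_within[OF X] by (simp add: adjacent_def)
next
  case False
  show ?thesis
  proof (cases "adjacent X Y")
    case True
    then obtain q where q: "q \<in> pairs" "tied X q" "q \<subseteq> Y" by (auto simp: adjacent_def)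
    then have "{q \<in> pairs. tied X q \<and> q \<subseteq> Y} = {q}"
      using tied_unique[OF X Y False] by blast
    then show ?thesis using True False by simp
  next
    case nonadj: False
    then have "{q \<in> pairs. tied X q \<and> q \<subseteq> Y} = {}"
      using False by (auto simp: adjacent_def)
    then have "card {q \<in> pairs. tied X q \<and> q \<subseteq> Y} = 0" by (simp only: card.empty)
    then show ?thesis using nonadj False by simp
  qed
qed

text \<open>
  The opposite product is \<open>8 I + J\<close>. If \<open>p = q\<close>, all nine triples over \<open>p\<close> count. If \<open>p\<close> and \<open>q\<close>
  share one point, only \<open>p \<union> q\<close> does. If they are disjoint, they span a unique block, and only that
  block without \<open>q\<close> counts; this is where the Steiner property enters.
\<close>

lemma card_tied_over:
  assumes p: "p \<in> pairs" and q: "q \<in> pairs"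
  shows "card {Z \<in> triples. p \<subseteq> Z \<and> tied Z q} = 8 * of_bool (p = q) + 1"
proof -
  have fin: "finite p" "finite q" and card: "card p = 2" "card q = 2" and sub: "p \<subseteq> P" "q \<subseteq> P"
    using p q finite_sub by (auto simp: pairs_def)
  have union: "card (p \<union> q) + card (p \<inter> q) = 4"
    using card_Un_Int[OF fin] card by simp
  show ?thesis
  proof (cases "p = q")
    case True
    have "{Z \<in> triples. p \<subseteq> Z \<and> tied Z q} = (\<lambda>x. insert x p) ` (P - p)"
    proof (intro equalityI subsetI)
      fix Z assume "Z \<in> {Z \<in> triples. p \<subseteq> Z \<and> tied Z q}"
      then have Z: "Z \<subseteq> P" "card Z = 3" "p \<subseteq> Z" by (auto simp: triples_def)
      then have "card (Z - p) = 1" using fin card by (simp add: card_Diff_subset)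
      then obtain x where "Z - p = {x}" by (metis One_nat_def card_1_singletonE)
      then show "Z \<in> (\<lambda>x. insert x p) ` (P - p)" using Z by blast
    qed (use True fin card sub in \<open>auto simp: triples_def tied_def\<close>)
    moreover have "inj_on (\<lambda>x. insert x p) (P - p)" by (auto simp: inj_on_def)
    moreover have "card (P - p) = 9"
      using fin card sub card_P by (simp add: card_Diff_subset)
    ultimately show ?thesis using True by (simp add: card_image)
  next
    case False
    have "\<exists>Z. {Z \<in> triples. p \<subseteq> Z \<and> tied Z q} = {Z}"
    proof (cases "p \<inter> q = {}")
      case True
      then have "card (p \<union> q) = 4" using union by simp
      then have "\<exists>!B. B \<in> blocks \<and> p \<union> q \<subseteq> B" using sub by (intro steiner) auto
      then obtain B where B_pq: "B \<in> blocks \<and> p \<union> q \<subseteq> B"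
          and unique: "\<forall>B'. B' \<in> blocks \<and> p \<union> q \<subseteq> B' \<longrightarrow> B' = B"
        by (rule ex1E)
      from B_pq have B: "B \<in> blocks" "p \<union> q \<subseteq> B" by simp_all
      have "card (B - q) = 3"
        using B fin card card_block by (simp add: card_Diff_subset)
      then have "B - q \<in> triples" using B block_sub by (auto simp: triples_def)
      moreover have "p \<subseteq> B - q" using B True by blast
      moreover have "tied (B - q) q"
        using B by (auto simp: tied_def Un_absorb2)
      moreover have "Z = B - q" if Z: "Z \<in> triples" "p \<subseteq> Z" "tied Z q" for Z
      proof -
        have "\<not> q \<subseteq> Z"
        proof
          assume "q \<subseteq> Z"
          then have "p \<union> q \<subseteq> Z" using Z by simp
          then have "card (p \<union> q) \<le> card Z"
            using Z finite_sub[of Z] by (intro card_mono) (auto simp: triples_def)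
          then show False using Z \<open>card (p \<union> q) = 4\<close> by (simp add: triples_def)
        qed
        then have "Z \<inter> q = {}" "Z \<union> q \<in> blocks" using Z by (auto simp: tied_def)
        then show ?thesis using unique[rule_format, of "Z \<union> q"] Z by blast
      qed
      ultimately show ?thesis by blast
    next
      case meet: False
      have "card (p \<inter> q) \<noteq> 2"
        using False fin card by (metis card_subset_eq inf_le1 inf_le2)
      moreover have "card (p \<inter> q) \<noteq> 0" using meet fin by simp
      moreover have "card (p \<inter> q) \<le> 2" using fin card by (metis card_mono inf_le1)
      ultimately have three: "card (p \<union> q) = 3" using union by simp
      have "p \<union> q \<in> triples" using three sub by (simp add: triples_def)
      moreover have "tied (p \<union> q) q" by (simp add: tied_def)
      moreover have "Z = p \<union> q" if Z: "Z \<in> triples" "p \<subseteq> Z" "tied Z q" for Z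
      proof -
        have "p \<union> q \<subseteq> Z" using Z meet by (auto simp: tied_def)
        then show ?thesis
          using Z three finite_sub card_subset_eq[of Z "p \<union> q"] by (auto simp: triples_def)
      qed
      ultimately show ?thesis by blast
    qed
    then obtain Z where "{Z \<in> triples. p \<subseteq> Z \<and> tied Z q} = {Z}" ..
    then show ?thesis using False by simp
  qed
qed

theorem triples_directed_srg: "directed_srg 165 60 36 23 21 (rel_digraph triples adjacent)"
proof -
  have inter: "A \<inter> {z. Q z} = {z \<in> A. Q z}" for A :: "'a set set" and Q by auto
  have "directed_srg (card triples) 60 36 23 21 (rel_digraph triples adjacent)"
  proof (rule factorization_directed_srg[where Q = pairs and s = 3 and a = 8 and c = 1
        and r = 7 and r' = 3
        and M = "\<lambda>X q. of_bool (tied X q)" and N = "\<lambda>q X. of_bool (q \<subseteq> X)"])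
    show "triples \<noteq> {}" using card_triples by auto
    show "(\<Sum>q\<in>pairs. of_bool (tied X q) * of_bool (q \<subseteq> Y)) =
        of_bool (adjacent X Y) + 3 * (of_bool (X = Y) :: int)" if "X \<in> triples" "Y \<in> triples" for X Y
      using card_tied_within[OF that] finite_pairs
      by (simp add: of_bool_conj[symmetric] inter)
    show "(\<Sum>Z\<in>triples. of_bool (p \<subseteq> Z) * of_bool (tied Z q)) =
        8 * of_bool (p = q) + (1 :: int)" if "p \<in> pairs" "q \<in> pairs" for p q
      using card_tied_over[OF that] finite_triples
      by (simp add: of_bool_conj[symmetric] inter)
    show "(\<Sum>q\<in>pairs. of_bool (tied X q)) = (7 :: int)" if "X \<in> triples" for X
      using card_tied[OF that] finite_pairs by (simp add: inter)
    show "(\<Sum>q\<in>pairs. of_bool (q \<subseteq> Y)) = (3 :: int)" if "Y \<in> triples" for Y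
      using card_pairs_within[OF that] finite_pairs by (simp add: inter)
  qed (use finite_triples finite_pairs card_pairs in \<open>auto simp: adjacent_def\<close>)
  then show ?thesis by (simp add: card_triples)
qed

end

text \<open>
  The orbits of the quadratic residues and of one further set under the affine maps of \<open>\<int> / 11\<close> whose
  linear coefficient \<open>a\<close> is a quadratic residue. The residues are fixed by multiplication with \<open>a\<close>,
  so translations suffice for the first orbit: there are 11 + 55 = 66 blocks.
\<close>

definition block_list :: "nat list list" where
  "block_list = [map (\<lambda>x. (x + b) mod 11) [1, 3, 4, 5, 9]. b \<leftarrow> [0..<11]] @
     [map (\<lambda>x. (a * x + b) mod 11) [0, 1, 2, 3, 5]. a \<leftarrow> [1, 3, 4, 5, 9], b \<leftarrow> [0..<11]]"

lemma block_list_points: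
  "\<forall>L\<in>set block_list. distinct L \<and> length L = 5 \<and> (\<forall>x\<in>set L. x < 11)"
  by code_simp

text \<open>
  Filtering by one point at a time leaves thirty, twelve and four blocks at the inner levels, which
  makes the search over all 330 sets of four points cheap.
\<close>

fun through :: "nat \<Rightarrow> nat list list \<Rightarrow> nat list list" where
  "through a Ls = filter (\<lambda>L. a \<in> set L) Ls"

definition four_point_check :: "nat list list \<Rightarrow> bool" where
  "four_point_check Ls \<longleftrightarrow>
     (\<forall>a\<in>set [0..<11]. let Ls1 = through a Ls in
      \<forall>b\<in>set [Suc a..<11]. let Ls2 = through b Ls1 in
      \<forall>c\<in>set [Suc b..<11]. let Ls3 = through c Ls2 in
      \<forall>d\<in>set [Suc c..<11]. length (through d Ls3) = 1)"

lemma four_point_check_block_list: "four_point_check block_list"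
  by code_simp

lemma steiner_blocks: "steiner_4_5_11 {..<11} (set ` set block_list)"
proof
  show "card {..<11::nat} = 11" by simp
  show "B \<subseteq> {..<11}" "card B = 5" if "B \<in> set ` set block_list" for B
    using that block_list_points by (auto simp: distinct_card)
  fix F :: "nat set" assume F: "F \<subseteq> {..<11}" "card F = 4"
  then have fin: "finite F" using finite_subset by blast
  define xs where "xs = sorted_list_of_set F"
  have "length xs = 4" using F by (simp add: xs_def)
  then obtain a b c d where abcd: "xs = [a, b, c, d]"
    by (auto simp: eval_nat_numeral length_Suc_conv)
  have F_eq: "F = {a, b, c, d}"
    using set_sorted_list_of_set[OF fin] abcd by (auto simp: xs_def)
  have "a < b \<and> b < c \<and> c < d"
    using strict_sorted_list_of_set[of F] abcd unfolding xs_def[symmetric] by simp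
  moreover have "d < 11" using F F_eq by simp
  ultimately have "a \<in> set [0..<11]" "b \<in> set [Suc a..<11]" "c \<in> set [Suc b..<11]"
    "d \<in> set [Suc c..<11]"
    by simp_all
  then have "length (through d (through c (through b (through a block_list)))) = 1"
    using four_point_check_block_list unfolding four_point_check_def Let_def by blast
  then have "length (filter (\<lambda>L. F \<subseteq> set L) block_list) = 1"
    by (simp add: F_eq conj_ac)
  then obtain L where "filter (\<lambda>L. F \<subseteq> set L) block_list = [L]"
    by (auto simp: length_Suc_conv)
  then have "set (filter (\<lambda>L. F \<subseteq> set L) block_list) = {L}" by simp
  then have only: "K \<in> set block_list \<and> F \<subseteq> set K \<longleftrightarrow> K = L" for K
    by auto
  show "\<exists>!B. B \<in> set ` set block_list \<and> F \<subseteq> B"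
  proof (rule ex1I[of _ "set L"])
    show "set L \<in> set ` set block_list \<and> F \<subseteq> set L" using only[of L] by simp
    fix B assume "B \<in> set ` set block_list \<and> F \<subseteq> B"
    then obtain K where "K \<in> set block_list" "F \<subseteq> set K" "B = set K" by auto
    then show "B = set L" using only[of K] by simp
  qed
qed

lemma ex_dsrg_165_60: "\<exists>H :: nat pair_pre_digraph. directed_srg 165 60 36 23 21 H"
  using steiner_4_5_11.triples_directed_srg[OF steiner_blocks] by (rule directed_srg_on_nat)

section \<open>Existence for the eight parameter sets\<close>

theorem mainTheorem2:
  shows "\<forall>(n, k, t, l, \<mu>) \<in>
    {(72, 25, 15, 6, 10), (96, 11, 4, 3, 1), (96, 22, 16, 8, 4), (96, 26, 11, 7, 7),
     (96, 29, 23, 10, 8), (96, 42, 32, 16, 20), (96, 45, 35, 22, 20), (165, 60, 36, 23, 21)}.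
    \<exists>G :: nat pair_pre_digraph. directed_srg n k t l \<mu> G"
  using ex_dsrg_72_25 ex_dsrg_96_11 ex_dsrg_96_22 ex_dsrg_96_26 ex_dsrg_96_29 ex_dsrg_96_42
    ex_dsrg_96_45 ex_dsrg_165_60
  by simp

end
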